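(* For $i=1,2$ let $C_i\subset\mathbb{R}^{n_i}$ be a closed convex cone with non-empty interior which contains no non-trivial linear subspace, let $P_i\subset C_i$ be a convex set such that $C_i\setminus P_i$ is bounded, and let $K_i$ be the corresponding co-convex body, i.e. the closure of $C_i\setminus P_i$. Let $K_1\oplus K_2\subset C_1\times C_2\subset\mathbb{R}^{n_1}\times\mathbb{R}^{n_2}$ be the free sum of $K_1$ and $K_2$. Then $$\mathrm{Vol}_{n_1+n_2}(K_1\oplus K_2)=\mathrm{Vol}_{n_1}(K_1)\,\mathrm{Vol}_{n_2}(K_2).$$
   Context: Cones have their apex at the origin. $\mathrm{Vol}_n=n!\,\mathrm{vol}_n$ denotes the normalized volume in $\mathbb{R}^n$, where $\mathrm{vol}_n$ is the usual Euclidean volume (Lebesgue measure). Free sum of convex sets: for $P_1\subset C_1$, $P_2\subset C_2$ as in the claim, $P_1\oplus P_2$ is the convex hull of $(P_1\times\{0\})\cup(\{0\}\times P_2)$ in $\mathbb{R}^{n_1}\times\mathbb{R}^{n_2}$. Free sum of co-convex bodies: $K_1\oplus K_2$ is the closure of the complement $(C_1\times C_2)\setminus(P_1\oplus P_2)$. *)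

theory Defs
  imports "HOL-Analysis.Analysis"
begin

text \<open>
  Volumes take values in \<^typ>\<open>ennreal\<close>, so that a set of infinite measure is not
  silently assigned volume 0 (as \<^const>\<open>measure\<close> would do).
\<close>

definition Vol :: "'a::euclidean_space set \<Rightarrow> ennreal" where
  "Vol S = of_nat (fact DIM('a)) * emeasure lebesgue S"

definition pointed_cone :: "'a::euclidean_space set \<Rightarrow> bool" where
  "pointed_cone C \<longleftrightarrow>
     closed C \<and> convex C \<and> cone C \<and> interior C \<noteq> {} \<and>
     (\<forall>V. subspace V \<and> V \<subseteq> C \<longrightarrow> V = {0})"

definition coconvex_body :: "'a::euclidean_space set \<Rightarrow> 'a set \<Rightarrow> 'a set" where
  "coconvex_body C P = closure (C - P)"

definition free_sum ::
    "'a::euclidean_space set \<Rightarrow> 'b::euclidean_space set \<Rightarrow> ('a \<times> 'b) set" where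
  "free_sum P1 P2 = convex hull (P1 \<times> {0} \<union> {0} \<times> P2)"

text \<open>
  The free sum of the co-convex bodies $K_i$ is defined through the data $(C_i, P_i)$,
  since the closed set $K_i$ does not remember which boundary points belong to $P_i$.
\<close>

definition coconvex_free_sum ::
    "'a::euclidean_space set \<Rightarrow> 'a set \<Rightarrow> 'b::euclidean_space set \<Rightarrow> 'b set \<Rightarrow> ('a \<times> 'b) set" where
  "coconvex_free_sum C1 P1 C2 P2 = closure ((C1 \<times> C2) - free_sum P1 P2)"

end

theory Submission
  imports Defs "HOL-Probability.Distributions"
begin

text \<open>
  Every level set \<open>{x \<in> C. f x < t}\<close> of a function \<open>f\<close> on an \<open>n\<close>-dimensional cone \<open>C\<close> which is
  homogeneous of degree 1 is a dilate of \<open>{x \<in> C. f x < 1}\<close>, so that the normalized volume of the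
  latter is the integral of \<open>exp (- f)\<close> over \<open>C\<close>. Up to a null set, \<open>C - P\<close> is such a sublevel set,
  for \<open>f x = sup {t > 0. x \<in> t P}\<close>. The function that belongs to the free sum is
  \<open>f1 x + f2 y\<close>, hence its exponential integral is a product.

  The interiors of \<open>C\<close> and \<open>P\<close> take the place of \<open>C\<close> and \<open>P\<close>: this gives measurability, and
  changes the co-convex body only inside the boundary of the convex set \<open>C\<close>.
\<close>

section \<open>Ray times and their exponential weights\<close>

text \<open>A Minkowski gauge with a supremum in place of the infimum, because the sets of interest
  contain the far part of each ray. In \<open>ennreal\<close> the supremum may be infinite, and an
  empty one is 0.\<close>

definition ray_time :: "'a::real_vector set \<Rightarrow> 'a \<Rightarrow> ennreal" where
  "ray_time Q x = (SUP t\<in>{t. 0 < t \<and> inverse t *\<^sub>R x \<in> Q}. ennreal t)"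

text \<open>The case split matters: \<open>enn2real top\<close> is 0, which would give infinity the
  weight 1.\<close>

definition exp_neg :: "ennreal \<Rightarrow> ennreal" where
  "exp_neg a = (if a = top then 0 else ennreal (exp (- enn2real a)))"

text \<open>
  This equals \<open>exp_neg (ray_time Q x)\<close> on the rays of interest, but its measurability in \<open>x\<close> is
  immediate. Note that \<open>ray_time\<close> is infinite when \<open>Q\<close> accumulates at the apex.
\<close>

definition missed_mass :: "'a::real_vector set \<Rightarrow> 'a \<Rightarrow> ennreal" where
  "missed_mass Q x =
     (\<integral>\<^sup>+t. ennreal (exp (- t)) * indicator {t. 0 < t \<and> inverse t *\<^sub>R x \<notin> Q} t \<partial>lborel)"

lemma exp_neg_add: "exp_neg (a + b) = exp_neg a * exp_neg b"
proof (cases "a = top \<or> b = top")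
  case True
  then show ?thesis by (auto simp: exp_neg_def)
next
  case False
  then have "enn2real (a + b) = enn2real a + enn2real b"
    by (intro enn2real_plus) (auto simp: less_top)
  with False show ?thesis
    by (simp add: exp_neg_def exp_add exp_diff ennreal_mult[symmetric] exp_minus field_simps)
qed

lemma nn_integral_exp_minus_atLeast:
  assumes "0 \<le> r"
  shows "(\<integral>\<^sup>+t. ennreal (exp (- t)) * indicator {r..} t \<partial>lborel) = ennreal (exp (- r))"
proof -
  have "(\<integral>\<^sup>+t. ennreal (exp (- t)) * indicator {r..} t \<partial>lborel) = ennreal (0 - (- exp (- r)))"
  proof (rule nn_integral_FTC_atLeast)
    show "((\<lambda>t::real. - exp (- t)) \<longlongrightarrow> 0) at_top"
      using tendsto_minus[OF filterlim_compose[OF exp_at_bot filterlim_uminus_at_bot_at_top]] by simp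
  qed (auto intro!: derivative_eq_intros)
  then show ?thesis by simp
qed

lemma le_ray_time: "0 < t \<Longrightarrow> inverse t *\<^sub>R x \<in> Q \<Longrightarrow> ennreal t \<le> ray_time Q x"
  unfolding ray_time_def by (rule SUP_upper) auto

text \<open>By \<open>down\<close> the admissible parameters form an initial segment of the positive
  reals, so everything strictly below the supremum is admissible; the supremum itself need not
  be.\<close>

lemma less_ray_time_imp:
  assumes "0 < t" "ennreal t < ray_time Q x"
    and down: "\<And>s t. 0 < s \<Longrightarrow> s < t \<Longrightarrow> inverse t *\<^sub>R x \<in> Q \<Longrightarrow> inverse s *\<^sub>R x \<in> Q"
  shows "inverse t *\<^sub>R x \<in> Q"
proof -
  from assms(2) obtain u where u: "0 < u" "inverse u *\<^sub>R x \<in> Q" "ennreal t < ennreal u"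
    by (auto simp: ray_time_def less_SUP_iff)
  with assms(1) have "t < u" by (simp add: ennreal_less_iff)
  with u assms(1) down show ?thesis by blast
qed

text \<open>For a finite ray time \<open>r\<close>, the missed parameters are, up to a null set, the
  half-line \<open>{r..}\<close>, whose exponential mass is \<open>exp (- r)\<close>.\<close>

lemma missed_mass_eq_exp_neg:
  assumes down: "\<And>s t. 0 < s \<Longrightarrow> s < t \<Longrightarrow> inverse t *\<^sub>R x \<in> Q \<Longrightarrow> inverse s *\<^sub>R x \<in> Q"
  shows "missed_mass Q x = exp_neg (ray_time Q x)"
proof (cases "ray_time Q x")
  case top
  then have "{t. 0 < t \<and> inverse t *\<^sub>R x \<notin> Q} = {}"
    using less_ray_time_imp[OF _ _ down] by (auto simp: top.not_eq_extremum)
  with top show ?thesis by (simp add: missed_mass_def exp_neg_def)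
next
  case (real r)
  \<comment> \<open>At \<open>t = r\<close> membership depends on whether the supremum is attained;
    \<open>t = 0\<close> belongs to \<open>{r..}\<close> when \<open>r = 0\<close> but is never a
    missed parameter.\<close>
  have ae: "AE t in lborel. t \<noteq> r \<and> t \<noteq> (0::real)"
    using AE_lborel_singleton[of r] AE_lborel_singleton[of "0::real"] by eventually_elim auto
  have "(t \<in> {t. 0 < t \<and> inverse t *\<^sub>R x \<notin> Q}) = (t \<in> {r..})" if "t \<noteq> r" "t \<noteq> 0" for t
  proof (cases "0 < t")
    case True
    have "t < r \<Longrightarrow> inverse t *\<^sub>R x \<in> Q"
      using less_ray_time_imp[OF True _ down] True real by (simp add: ennreal_less_iff)
    moreover have "inverse t *\<^sub>R x \<in> Q \<Longrightarrow> t \<le> r"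
      using le_ray_time[OF True, of x Q] real by (simp add: ennreal_le_iff)
    ultimately show ?thesis using True that by force
  qed (use that real in auto)
  with ae have "missed_mass Q x = (\<integral>\<^sup>+t. ennreal (exp (- t)) * indicator {r..} t \<partial>lborel)"
    unfolding missed_mass_def by (intro nn_integral_cong_AE) (auto simp: indicator_def)
  with real show ?thesis
    by (simp add: exp_neg_def nn_integral_exp_minus_atLeast)
qed

section \<open>Dilations and the exponential integral over a cone\<close>

lemma emeasure_lborel_scaleR_image:
  fixes A :: "'a::euclidean_space set"
  assumes "0 < t" "A \<in> sets borel"
  shows "emeasure lborel ((*\<^sub>R) t ` A) = ennreal (t ^ DIM('a)) * emeasure lborel A"
proof -
  \<comment> \<open>Seen as a preimage, the image is Borel, so the scaling rule for
    \<open>lebesgue\<close> carries over to \<open>lborel\<close>.\<close>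
  have "(*\<^sub>R) t ` A = (\<lambda>x. inverse t *\<^sub>R x) -` A"
  proof (intro set_eqI iffI)
    fix x assume "x \<in> (\<lambda>x. inverse t *\<^sub>R x) -` A"
    then show "x \<in> (*\<^sub>R) t ` A"
      using assms(1) by (intro image_eqI[of _ _ "inverse t *\<^sub>R x"]) auto
  qed (use assms(1) in auto)
  moreover have "(\<lambda>x. inverse t *\<^sub>R x) -` A \<in> sets borel"
    using measurable_sets[of "\<lambda>x. inverse t *\<^sub>R x" borel borel A] assms(2) by simp
  ultimately have "(*\<^sub>R) t ` A \<in> sets lborel" by simp
  then show ?thesis
    using emeasure_lebesgue_affine[of t 0 A] assms by simp
qed

lemma measurable_missed_mass_integrand:
  fixes Q :: "'a::euclidean_space set"
  assumes "open Q"
  shows "(\<lambda>(x, t). ennreal (exp (- t)) * indicator {t. 0 < t \<and> inverse t *\<^sub>R x \<notin> Q} t)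
    \<in> borel_measurable (lborel \<Otimes>\<^sub>M (lborel :: real measure))"
proof -
  have [measurable]: "Q \<in> sets borel" using assms by simp
  have "(\<lambda>(x, t). ennreal (exp (- t)) * indicator {t. 0 < t \<and> inverse t *\<^sub>R x \<notin> Q} t)
    = (\<lambda>z. ennreal (exp (- snd z)) * indicator {0<..} (snd z) * indicator (- Q) (inverse (snd z) *\<^sub>R fst z))"
    by (auto simp: fun_eq_iff indicator_def)
  also have "\<dots> \<in> borel_measurable (lborel \<Otimes>\<^sub>M (lborel :: real measure))"
    by measurable
  finally show ?thesis .
qed

lemma measurable_missed_mass:
  fixes Q :: "'a::euclidean_space set"
  assumes "open Q"
  shows "missed_mass Q \<in> borel_measurable borel"
proof -
  have "(\<lambda>x. missed_mass Q x) \<in> borel_measurable lborel"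
    unfolding missed_mass_def
    using measurable_missed_mass_integrand[OF assms] by (rule lborel.borel_measurable_nn_integral)
  then show ?thesis by simp
qed

text \<open>Tonelli: for fixed \<open>t > 0\<close> the points of \<open>U\<close> missed at time
  \<open>t\<close> form the dilate of \<open>U - Q\<close> by \<open>t\<close>, which contributes
  the factor \<open>t ^ DIM('a)\<close>; integrating this against \<open>exp (- t)\<close> gives the
  factorial.\<close>

lemma nn_integral_missed_mass:
  fixes U Q :: "'a::euclidean_space set"
  assumes "open U" "open Q" and cone: "\<And>c x. 0 < c \<Longrightarrow> x \<in> U \<Longrightarrow> c *\<^sub>R x \<in> U"
  shows "(\<integral>\<^sup>+x. indicator U x * missed_mass Q x \<partial>lborel) = fact DIM('a) * emeasure lborel (U - Q)"
proof -
  let ?h = "\<lambda>x t. ennreal (exp (- t)) * indicator {t. 0 < t \<and> inverse t *\<^sub>R x \<notin> Q} t"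
  have [measurable]: "U \<in> sets borel" "Q \<in> sets borel" using assms by simp_all
  note h [measurable] = measurable_missed_mass_integrand[OF \<open>open Q\<close>]
  have hU: "(\<lambda>(x, t). indicator U x * ?h x t) \<in> borel_measurable (lborel \<Otimes>\<^sub>M lborel)"
  proof -
    have "(\<lambda>z. indicator U (fst z) * (\<lambda>(x, t). ?h x t) z) \<in> borel_measurable (lborel \<Otimes>\<^sub>M lborel)"
      by measurable
    then show ?thesis by (simp add: split_beta')
  qed
  have hx: "?h x \<in> borel_measurable lborel" for x
    using measurable_Pair2[OF h, of x] by simp
  \<comment> \<open>The Gamma integral yields a real factorial, while the goal has one in
    \<open>ennreal\<close>.\<close>
  have fact: "ennreal (fact n) = fact n" for n
    by (metis ennreal_of_nat_eq_real_of_nat of_nat_fact)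
  have img: "{x \<in> U. inverse t *\<^sub>R x \<notin> Q} = (*\<^sub>R) t ` (U - Q)" if "0 < t" for t
  proof (intro set_eqI iffI)
    fix x assume "x \<in> {x \<in> U. inverse t *\<^sub>R x \<notin> Q}"
    then show "x \<in> (*\<^sub>R) t ` (U - Q)"
      using that cone by (intro image_eqI[of _ _ "inverse t *\<^sub>R x"]) auto
  qed (use that cone in auto)
  have "(\<integral>\<^sup>+x. indicator U x * missed_mass Q x \<partial>lborel) = (\<integral>\<^sup>+x. (\<integral>\<^sup>+t. indicator U x * ?h x t \<partial>lborel) \<partial>lborel)"
    unfolding missed_mass_def by (intro nn_integral_cong nn_integral_cmult[symmetric] hx)
  also have "\<dots> = (\<integral>\<^sup>+t. (\<integral>\<^sup>+x. indicator U x * ?h x t \<partial>lborel) \<partial>lborel)"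
    by (rule lborel_pair.Fubini'[OF hU, symmetric])
  also have "\<dots> = (\<integral>\<^sup>+t. ennreal (t ^ DIM('a) * exp (- t)) * indicator {0..} t * emeasure lborel (U - Q) \<partial>lborel)"
  proof (intro nn_integral_cong_AE)
    show "AE t in lborel. (\<integral>\<^sup>+x. indicator U x * ?h x t \<partial>lborel) =
      ennreal (t ^ DIM('a) * exp (- t)) * indicator {0..} t * emeasure lborel (U - Q)"
      using AE_lborel_singleton[of "0::real"]
    proof eventually_elim
      case (elim t)
      show ?case
      proof (cases "0 < t")
        case True
        have "(\<integral>\<^sup>+x. indicator U x * ?h x t \<partial>lborel)
          = (\<integral>\<^sup>+x. ennreal (exp (- t)) * indicator ((*\<^sub>R) t ` (U - Q)) x \<partial>lborel)"
          using True by (intro nn_integral_cong) (auto simp: indicator_def img[OF True, symmetric])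
        also have "\<dots> = ennreal (exp (- t)) * emeasure lborel ((*\<^sub>R) t ` (U - Q))"
          by (intro nn_integral_cmult_indicator) (simp add: img[OF True, symmetric])
        also have "\<dots> = ennreal (exp (- t)) * (ennreal (t ^ DIM('a)) * emeasure lborel (U - Q))"
          using True by (subst emeasure_lborel_scaleR_image) auto
        finally show ?thesis using True by (simp add: ennreal_mult mult_ac)
      qed (use elim in simp)
    qed
  qed
  also have "\<dots> = fact DIM('a) * emeasure lborel (U - Q)"
    by (simp add: nn_integral_multc nn_intergal_power_times_exp_Ici fact)
  finally show ?thesis .
qed

section \<open>Points of the free sum\<close>

lemma scaled_pair_mem_free_sum:
  assumes "0 \<le> s" "s \<le> 1" "p \<in> P1" "q \<in> P2"
  shows "(s *\<^sub>R p, (1 - s) *\<^sub>R q) \<in> free_sum P1 P2"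
proof -
  have "(p, 0) \<in> free_sum P1 P2" "(0, q) \<in> free_sum P1 P2"
    unfolding free_sum_def using assms by (auto intro!: hull_inc)
  then have "s *\<^sub>R (p, 0) + (1 - s) *\<^sub>R (0, q) \<in> free_sum P1 P2"
    using assms by (intro convexD) (auto simp: free_sum_def)
  then show ?thesis by simp
qed

text \<open>In the hull of the union of two nonempty convex sets, every point is a convex
  combination of just one point from each.\<close>

lemma mem_free_sumE:
  fixes P1 :: "'a::euclidean_space set" and P2 :: "'b::euclidean_space set"
  assumes "z \<in> free_sum P1 P2" "convex P1" "convex P2" "P1 \<noteq> {}" "P2 \<noteq> {}"
  obtains s p q where "0 \<le> s" "s \<le> 1" "p \<in> P1" "q \<in> P2" "z = (s *\<^sub>R p, (1 - s) *\<^sub>R q)"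
proof -
  have "convex (P1 \<times> {0::'b})" "convex ({0::'a} \<times> P2)"
    using assms by (auto intro: convex_Times)
  then have "free_sum P1 P2 = {u *\<^sub>R x + v *\<^sub>R y | u v x y. 0 \<le> u \<and> 0 \<le> v \<and> u + v = 1 \<and>
      x \<in> P1 \<times> {0::'b} \<and> y \<in> {0::'a} \<times> P2}"
    unfolding free_sum_def using assms by (subst convex_hull_union_two) auto
  with assms(1) obtain u v x y where *: "z = u *\<^sub>R x + v *\<^sub>R y" "0 \<le> u" "0 \<le> v" "u + v = 1"
      "x \<in> P1 \<times> {0::'b}" "y \<in> {0::'a} \<times> P2"
    by auto
  then have "v = 1 - u" by simp
  with * show ?thesis by (intro that[of u "fst x" "snd y"]) (auto simp: prod_eq_iff)
qed

section \<open>Rays running into a convex set\<close>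

text \<open>A ball around \<open>x\<close> inside \<open>C\<close> stays in the cone when divided by
  \<open>t\<close>; for small \<open>t\<close> it clears the bounded set \<open>C - P\<close> and
  hence lies in \<open>P\<close>.\<close>

lemma ray_enters_interior:
  fixes C P :: "'a::euclidean_space set"
  assumes "cone C" "bounded (C - P)" "x \<in> interior C" "x \<noteq> 0"
  obtains e where "0 < e" "\<And>t. 0 < t \<Longrightarrow> t < e \<Longrightarrow> inverse t *\<^sub>R x \<in> interior P"
proof -
  obtain r0 where r0: "0 < r0" "ball x r0 \<subseteq> C" using assms(3) by (auto simp: mem_interior)
  obtain B where B: "0 < B" "\<And>y. y \<in> C - P \<Longrightarrow> norm y \<le> B"
    using assms(2) by (auto simp: bounded_pos)
  \<comment> \<open>Points of \<open>ball x r\<close> have norm above \<open>norm x / 2\<close>;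
    dividing by \<open>t < e\<close> pushes the norm beyond \<open>B\<close>.\<close>
  define r where "r = min r0 (norm x / 2)"
  define e where "e = norm x / 2 / B"
  have r: "0 < r" "ball x r \<subseteq> C" "r \<le> norm x / 2" using r0 assms(4) by (auto simp: r_def)
  show thesis
  proof
    show "0 < e" using B assms(4) by (simp add: e_def)
    fix t assume t: "0 < t" "t < e"
    have "ball (inverse t *\<^sub>R x) (r / t) \<subseteq> P"
    proof
      fix y assume "y \<in> ball (inverse t *\<^sub>R x) (r / t)"
      moreover have "dist x (t *\<^sub>R y) = t * dist (inverse t *\<^sub>R x) y"
      proof -
        have "x - t *\<^sub>R y = t *\<^sub>R (inverse t *\<^sub>R x - y)" using t by (simp add: algebra_simps)
        then show ?thesis using t by (simp add: dist_norm)
      qed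
      ultimately have d: "dist x (t *\<^sub>R y) < r" using t by (simp add: field_simps)
      then have "t *\<^sub>R y \<in> C" using r by auto
      then have "inverse t *\<^sub>R (t *\<^sub>R y) \<in> C"
        using assms(1) t unfolding cone_def by (metis less_imp_le inverse_nonnegative_iff_nonnegative)
      then have "y \<in> C" using t by simp
      moreover have "B < norm y"
      proof -
        have "norm x \<le> norm (t *\<^sub>R y) + dist x (t *\<^sub>R y)"
          by (metis add.commute dist_norm norm_triangle_sub)
        then have "norm x / 2 < t * norm y" using d r t by simp
        moreover have "t * B < norm x / 2" using t B by (simp add: e_def field_simps)
        ultimately have "t * B < t * norm y" by simp
        then show ?thesis using t by simp
      qed
      ultimately show "y \<in> P" using B(2)[of y] by force
    qed
    then show "inverse t *\<^sub>R x \<in> interior P"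
      using r(1) t by (auto simp: mem_interior intro!: exI[of _ "r / t"])
  qed
qed

text \<open>The point lies on a segment from a point of \<open>P\<close> to an interior point
  further out on the ray, so convexity makes it interior. This supplies the \<open>down\<close>
  hypothesis above.\<close>

lemma ray_stays_in_interior:
  fixes P :: "'a::euclidean_space set"
  assumes "convex P" "0 < e" and enter: "\<And>t. 0 < t \<Longrightarrow> t < e \<Longrightarrow> inverse t *\<^sub>R x \<in> interior P"
    and st: "0 < s" "s < t" "inverse t *\<^sub>R x \<in> P"
  shows "inverse s *\<^sub>R x \<in> interior P"
proof -
  define u where "u = min e s / 2"
  have u: "0 < u" "u < e" "u < s" using assms by (auto simp: u_def)
  \<comment> \<open>The solution of
    \<open>inverse s = inverse t + a * (inverse u - inverse t)\<close>.\<close>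
  define a where "a = (inverse s - inverse t) / (inverse u - inverse t)"
  have lt: "inverse t < inverse s" "inverse s < inverse u" using u st by auto
  then have a: "0 < a" "a \<le> 1" by (auto simp: a_def)
  have "inverse t *\<^sub>R x - a *\<^sub>R (inverse t *\<^sub>R x - inverse u *\<^sub>R x) \<in> interior P"
    using mem_interior_convex_shrink[OF assms(1) enter st(3) a, of u] u by simp
  also have "inverse t *\<^sub>R x - a *\<^sub>R (inverse t *\<^sub>R x - inverse u *\<^sub>R x)
      = (inverse t + a * (inverse u - inverse t)) *\<^sub>R x"
    by (simp add: algebra_simps)
  also have "a * (inverse u - inverse t) = inverse s - inverse t"
  proof -
    have "inverse u - inverse t \<noteq> 0" using lt by linarith
    then show ?thesis unfolding a_def by (metis nonzero_mult_div_cancel_right times_divide_eq_left)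
  qed
  finally show ?thesis by simp
qed

text \<open>Passing to the interior does not lower the supremum: all positive parameters below
  \<open>t\<close> are admissible for the interior, even if \<open>t\<close> is not.\<close>

lemma le_ray_time_interior:
  fixes P :: "'a::euclidean_space set"
  assumes "convex P" "0 < e" and enter: "\<And>t. 0 < t \<Longrightarrow> t < e \<Longrightarrow> inverse t *\<^sub>R x \<in> interior P"
    and t: "0 < t" "inverse t *\<^sub>R x \<in> P"
  shows "ennreal t \<le> ray_time (interior P) x"
proof (rule ccontr)
  assume "\<not> ?thesis"
  then obtain r where r: "0 \<le> r" "r < t" "ray_time (interior P) x = ennreal r"
    by (cases "ray_time (interior P) x") (auto simp: ennreal_less_iff not_le)
  then obtain u where u: "r < u" "u < t" using dense by blast
  with r have "inverse u *\<^sub>R x \<in> interior P"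
    using ray_stays_in_interior[OF assms(1-3), of u t] t by simp
  then have "ennreal u \<le> ennreal r" using le_ray_time[of u x "interior P"] r u by simp
  with r u show False by simp
qed

section \<open>Additivity of the ray time under free sums\<close>

text \<open>With weights proportional to \<open>t1\<close> and \<open>t2\<close>, the point is a
  convex combination of the two given ones; letting these vary in the interiors fills an open
  product inside the free sum.\<close>

lemma pair_mem_interior_free_sum:
  fixes P1 :: "'a::euclidean_space set" and P2 :: "'b::euclidean_space set"
  assumes "0 < t1" "0 < t2" "inverse t1 *\<^sub>R x \<in> interior P1" "inverse t2 *\<^sub>R y \<in> interior P2"
  shows "inverse (t1 + t2) *\<^sub>R (x, y) \<in> interior (free_sum P1 P2)"
proof -
  define s where "s = t1 / (t1 + t2)"
  have s: "0 < s" "s < 1" using assms by (auto simp: s_def)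
  have "open ((*\<^sub>R) s ` interior P1 \<times> (*\<^sub>R) (1 - s) ` interior P2)" (is "open ?W")
    using s by (intro open_Times open_scaling) auto
  moreover have "?W \<subseteq> free_sum P1 P2"
    using s by (auto intro!: scaled_pair_mem_free_sum dest!: interior_subset[THEN subsetD])
  moreover have "inverse (t1 + t2) *\<^sub>R (x, y) \<in> ?W"
  proof -
    have 1: "inverse (t1 + t2) *\<^sub>R x = s *\<^sub>R (inverse t1 *\<^sub>R x)"
      using assms by (simp add: s_def field_simps)
    have "1 - s = t2 / (t1 + t2)"
      using assms by (simp add: s_def field_simps)
    then have 2: "inverse (t1 + t2) *\<^sub>R y = (1 - s) *\<^sub>R (inverse t2 *\<^sub>R y)"
      using assms by (simp add: field_simps)
    show ?thesis unfolding scaleR_Pair 1 2 using assms by (intro SigmaI imageI)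
  qed
  ultimately show ?thesis by (meson interior_maximal subsetD)
qed

text \<open>Splitting \<open>t\<close> into equal halves transfers entry from the factors to the
  free sum, so that \<open>ray_stays_in_interior\<close> applies there too.\<close>

lemma ray_enters_interior_free_sum:
  fixes P1 :: "'a::euclidean_space set" and P2 :: "'b::euclidean_space set"
  assumes "\<And>t. 0 < t \<Longrightarrow> t < e1 \<Longrightarrow> inverse t *\<^sub>R x \<in> interior P1"
    and "\<And>t. 0 < t \<Longrightarrow> t < e2 \<Longrightarrow> inverse t *\<^sub>R y \<in> interior P2"
    and "0 < t" "t < min e1 e2"
  shows "inverse t *\<^sub>R (x, y) \<in> interior (free_sum P1 P2)"
  using pair_mem_interior_free_sum[of "t / 2" "t / 2" x P1 y P2] assms(1,2)[of "t / 2"] assms(3,4) by simp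

text \<open>A convex combination with weight \<open>s\<close> splits a parameter \<open>t\<close> of
  the free sum into \<open>s * t\<close> and \<open>(1 - s) * t\<close>; conversely, parameters of
  the factors add up.\<close>

lemma ray_time_free_sum:
  fixes P1 :: "'a::euclidean_space set" and P2 :: "'b::euclidean_space set"
  assumes conv: "convex P1" "convex P2" and nz: "x \<noteq> 0" "y \<noteq> 0" and e: "0 < e1" "0 < e2"
    and enter1: "\<And>t. 0 < t \<Longrightarrow> t < e1 \<Longrightarrow> inverse t *\<^sub>R x \<in> interior P1"
    and enter2: "\<And>t. 0 < t \<Longrightarrow> t < e2 \<Longrightarrow> inverse t *\<^sub>R y \<in> interior P2"
  shows "ray_time (interior (free_sum P1 P2)) (x, y) =
    ray_time (interior P1) x + ray_time (interior P2) y"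
proof (rule antisym)
  show "ray_time (interior (free_sum P1 P2)) (x, y) \<le> ray_time (interior P1) x + ray_time (interior P2) y"
    unfolding ray_time_def[of "interior (free_sum P1 P2)"]
  proof (rule SUP_least)
    fix t assume "t \<in> {t. 0 < t \<and> inverse t *\<^sub>R (x, y) \<in> interior (free_sum P1 P2)}"
    then have t: "0 < t" "inverse t *\<^sub>R (x, y) \<in> free_sum P1 P2"
      using interior_subset by auto
    have "P1 \<noteq> {}" "P2 \<noteq> {}"
      using enter1[of "e1 / 2"] enter2[of "e2 / 2"] e interior_subset by auto
    with t conv obtain s p q where s: "0 \<le> s" "s \<le> 1" "p \<in> P1" "q \<in> P2"
        and eq: "inverse t *\<^sub>R (x, y) = (s *\<^sub>R p, (1 - s) *\<^sub>R q)"
      by (elim mem_free_sumE)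
    \<comment> \<open>Nonzero \<open>x\<close> and \<open>y\<close> exclude the end weights, so that
      both components can be divided by theirs.\<close>
    from eq t nz have "s \<noteq> 0" "1 - s \<noteq> 0" by auto
    with s have s01: "0 < s" "s < 1" by auto
    have "inverse (s * t) *\<^sub>R x = inverse s *\<^sub>R (inverse t *\<^sub>R x)" by simp
    also have "\<dots> = p" using eq s01 by simp
    finally have 1: "ennreal (s * t) \<le> ray_time (interior P1) x"
      using s s01 t by (intro le_ray_time_interior[OF conv(1) e(1) enter1]) auto
    have "inverse ((1 - s) * t) *\<^sub>R y = inverse (1 - s) *\<^sub>R (inverse t *\<^sub>R y)" by simp
    also have "\<dots> = q" using eq s01 by simp
    finally have 2: "ennreal ((1 - s) * t) \<le> ray_time (interior P2) y"
      using s s01 t by (intro le_ray_time_interior[OF conv(2) e(2) enter2]) auto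
    have "ennreal t = ennreal (s * t) + ennreal ((1 - s) * t)"
      using s01 t by (simp add: ennreal_plus[symmetric] algebra_simps del: ennreal_plus)
    also have "\<dots> \<le> ray_time (interior P1) x + ray_time (interior P2) y"
      using 1 2 by (rule add_mono)
    finally show "ennreal t \<le> ray_time (interior P1) x + ray_time (interior P2) y" .
  qed
next
  let ?S1 = "{t. 0 < t \<and> inverse t *\<^sub>R x \<in> interior P1}"
  let ?S2 = "{t. 0 < t \<and> inverse t *\<^sub>R y \<in> interior P2}"
  \<comment> \<open>An added constant moves inside a supremum only if the index set is
    nonempty.\<close>
  have ne: "?S1 \<noteq> {}" "?S2 \<noteq> {}"
    using enter1[of "e1 / 2"] enter2[of "e2 / 2"] e
    by (auto intro: exI[of _ "e1 / 2"] exI[of _ "e2 / 2"] simp del: inverse_divide)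
  have "ray_time (interior P1) x + ray_time (interior P2) y = (SUP t\<in>?S1. ennreal t + ray_time (interior P2) y)"
    unfolding ray_time_def[of _ x] using ne by (intro ennreal_SUP_add_left[symmetric])
  also have "\<dots> = (SUP t1\<in>?S1. SUP t2\<in>?S2. ennreal t1 + ennreal t2)"
    unfolding ray_time_def[of _ y] using ne by (intro SUP_cong refl ennreal_SUP_add_right)
  also have "\<dots> \<le> ray_time (interior (free_sum P1 P2)) (x, y)"
  proof (intro SUP_least)
    fix t1 t2 assume "t1 \<in> ?S1" "t2 \<in> ?S2"
    then have "ennreal (t1 + t2) \<le> ray_time (interior (free_sum P1 P2)) (x, y)"
      by (intro le_ray_time pair_mem_interior_free_sum) auto
    with \<open>t1 \<in> ?S1\<close> \<open>t2 \<in> ?S2\<close> show "ennreal t1 + ennreal t2 \<le> ray_time (interior (free_sum P1 P2)) (x, y)"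
      by simp
  qed
  finally show "ray_time (interior P1) x + ray_time (interior P2) y \<le> ray_time (interior (free_sum P1 P2)) (x, y)" .
qed

lemma missed_mass_free_sum:
  fixes P1 :: "'a::euclidean_space set" and P2 :: "'b::euclidean_space set"
  assumes conv: "convex P1" "convex P2" and cone: "cone C1" "cone C2"
    and bdd: "bounded (C1 - P1)" "bounded (C2 - P2)"
    and x: "x \<in> interior C1" "x \<noteq> 0" and y: "y \<in> interior C2" "y \<noteq> 0"
  shows "missed_mass (interior (free_sum P1 P2)) (x, y) =
    missed_mass (interior P1) x * missed_mass (interior P2) y"
proof -
  obtain e1 where e1: "0 < e1" "\<And>t. 0 < t \<Longrightarrow> t < e1 \<Longrightarrow> inverse t *\<^sub>R x \<in> interior P1"
    using ray_enters_interior[OF cone(1) bdd(1) x] by blast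
  obtain e2 where e2: "0 < e2" "\<And>t. 0 < t \<Longrightarrow> t < e2 \<Longrightarrow> inverse t *\<^sub>R y \<in> interior P2"
    using ray_enters_interior[OF cone(2) bdd(2) y] by blast
  \<comment> \<open>The type \<open>'c\<close> stays open, as this serves \<open>P1\<close>,
    \<open>P2\<close> and the free sum, which live in different spaces.\<close>
  have eq: "missed_mass (interior P) z = exp_neg (ray_time (interior P) z)"
    if "convex P" "0 < e" "\<And>t. 0 < t \<Longrightarrow> t < e \<Longrightarrow> inverse t *\<^sub>R z \<in> interior P"
    for P :: "'c::euclidean_space set" and z e
    using ray_stays_in_interior[OF that] interior_subset[of P]
    by (intro missed_mass_eq_exp_neg) blast
  have "convex (free_sum P1 P2)" by (simp add: free_sum_def)
  moreover have "0 < min e1 e2" using e1 e2 by simp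
  ultimately have "missed_mass (interior (free_sum P1 P2)) (x, y)
      = exp_neg (ray_time (interior (free_sum P1 P2)) (x, y))"
    by (rule eq) (rule ray_enters_interior_free_sum[OF e1(2) e2(2)])
  also have "\<dots> = exp_neg (ray_time (interior P1) x) * exp_neg (ray_time (interior P2) y)"
    using ray_time_free_sum[OF conv x(2) y(2) e1(1) e2(1) e1(2) e2(2)] by (simp add: exp_neg_add)
  finally show ?thesis using eq[OF conv(1) e1] eq[OF conv(2) e2] by simp
qed

section \<open>Cones and volumes of co-convex bodies\<close>

lemma cone_interior_scaleR:
  fixes C :: "'a::euclidean_space set"
  assumes "cone C" "0 < c" "x \<in> interior C"
  shows "c *\<^sub>R x \<in> interior C"
proof -
  have "open ((*\<^sub>R) c ` interior C)" using assms by (intro open_scaling) auto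
  moreover have "(*\<^sub>R) c ` interior C \<subseteq> C"
    using assms(1,2) interior_subset[of C] by (auto simp: cone_def)
  ultimately show ?thesis using assms(3) interior_maximal by blast
qed

text \<open>A cone with the apex in its interior is the whole space, a non-trivial subspace.\<close>

lemma pointed_cone_zero_notin_interior:
  fixes C :: "'a::euclidean_space set"
  assumes "pointed_cone C"
  shows "0 \<notin> interior C"
proof
  assume "0 \<in> interior C"
  then obtain r where r: "0 < r" "ball 0 r \<subseteq> C" by (auto simp: mem_interior)
  have "y \<in> C" for y
  proof -
    define c where "c = r / (norm y + 1)"
    have n: "0 < norm y + 1" by (simp add: add_nonneg_pos)
    have c: "0 < c" using r(1) n by (simp add: c_def)
    have "c * norm y < r" using r n by (simp add: c_def field_simps)
    then have "c *\<^sub>R y \<in> C" using r c by auto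
    then have "inverse c *\<^sub>R (c *\<^sub>R y) \<in> C"
      using assms c unfolding pointed_cone_def cone_def
      by (metis less_imp_le inverse_nonnegative_iff_nonnegative)
    then show ?thesis using c by simp
  qed
  then have "(UNIV :: 'a set) = {0}"
    using assms unfolding pointed_cone_def by (metis subspace_UNIV subsetI)
  then show False using nonempty_Basis nonzero_Basis by blast
qed

text \<open>The two sets differ only inside the frontier of the convex set \<open>C\<close>, which
  is negligible.\<close>

lemma Vol_coconvex_body:
  fixes C P :: "'a::euclidean_space set"
  assumes "closed C" "convex C"
  shows "Vol (coconvex_body C P) = fact DIM('a) * emeasure lborel (interior C - interior P)"
proof -
  have lo: "interior C - interior P \<subseteq> closure (C - P)"
  proof -
    \<comment> \<open>Points on the boundary of \<open>P\<close> are limits of points outside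
      \<open>P\<close>, and near a point of the open set \<open>interior C\<close> these lie in
      \<open>C\<close>.\<close>
    have "interior C \<inter> closure (- P) \<subseteq> closure (interior C \<inter> - P)"
      by (simp add: open_Int_closure_subset)
    also have "\<dots> \<subseteq> closure (C - P)" using interior_subset[of C] by (intro closure_mono) auto
    finally show ?thesis by (auto simp: closure_complement)
  qed
  have "closure (C - P) \<subseteq> C" using assms by (intro closure_minimal) auto
  moreover have "closure (C - P) \<subseteq> - interior P"
    unfolding closure_complement[symmetric] by (intro closure_mono) auto
  ultimately have hi: "closure (C - P) - (interior C - interior P) \<subseteq> frontier C"
    using assms(1) by (auto simp: frontier_def)
  have sets: "interior C - interior P \<in> sets lborel" "closure (C - P) \<in> sets lebesgue"
    "closure (C - P) - (interior C - interior P) \<in> sets lebesgue"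
    by (auto intro!: sets.Diff borel_open)
  have "closure (C - P) - (interior C - interior P) \<in> null_sets lebesgue"
    using negligible_subset[OF negligible_convex_frontier[OF assms(2)] hi]
    by (simp add: negligible_iff_null_sets)
  then have "emeasure lebesgue ((interior C - interior P) \<union> (closure (C - P) - (interior C - interior P)))
      = emeasure lebesgue (interior C - interior P)"
    using sets by (intro emeasure_Un_null_set) auto
  also have "(interior C - interior P) \<union> (closure (C - P) - (interior C - interior P)) = closure (C - P)"
    using lo by auto
  finally show ?thesis
    using sets by (simp add: Vol_def coconvex_body_def)
qed

lemma Vol_coconvex_body_eq_integral:
  fixes C P :: "'a::euclidean_space set"
  assumes "closed C" "convex C" "cone C"
  shows "Vol (coconvex_body C P) = (\<integral>\<^sup>+x. indicator (interior C) x * missed_mass (interior P) x \<partial>lborel)"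
  using assms
  by (subst nn_integral_missed_mass) (auto simp: Vol_coconvex_body intro: cone_interior_scaleR)

text \<open>The left side is itself the volume of a \<open>coconvex_body\<close>, for the cone
  \<open>C1 \<times> C2\<close>, so all three volumes become integrals of \<open>missed_mass\<close>
  and Tonelli separates the variables.\<close>

lemma Vol_coconvex_free_sum:
  fixes C1 P1 :: "'a::euclidean_space set" and C2 P2 :: "'b::euclidean_space set"
  assumes C: "pointed_cone C1" "pointed_cone C2"
    and conv: "convex P1" "convex P2" and bdd: "bounded (C1 - P1)" "bounded (C2 - P2)"
  shows "Vol (coconvex_free_sum C1 P1 C2 P2) = Vol (coconvex_body C1 P1) * Vol (coconvex_body C2 P2)"
proof -
  have c1: "closed C1" "convex C1" "cone C1" and c2: "closed C2" "convex C2" "cone C2"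
    using C by (auto simp: pointed_cone_def)
  have [measurable]: "interior C1 \<in> sets borel" "interior C2 \<in> sets borel" by simp_all
  let ?F = "free_sum P1 P2"
  let ?f = "\<lambda>x. indicator (interior C1) x * missed_mass (interior P1) x"
  let ?g = "\<lambda>y. indicator (interior C2) y * missed_mass (interior P2) y"
  have [measurable]: "missed_mass (interior P1) \<in> borel_measurable borel"
    "missed_mass (interior P2) \<in> borel_measurable borel"
    by (simp_all add: measurable_missed_mass)
  have "cone (C1 \<times> C2)" using c1 c2 by (auto simp: cone_def)
  then have "Vol (coconvex_body (C1 \<times> C2) ?F)
      = (\<integral>\<^sup>+z. indicator (interior (C1 \<times> C2)) z * missed_mass (interior ?F) z \<partial>lborel)"
    using c1 c2 by (intro Vol_coconvex_body_eq_integral) (auto intro: closed_Times convex_Times)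
  also have "\<dots> = (\<integral>\<^sup>+z. ?f (fst z) * ?g (snd z) \<partial>lborel)"
  proof (intro nn_integral_cong)
    fix z :: "'a \<times> 'b"
    obtain x y where z: "z = (x, y)" by fastforce
    show "indicator (interior (C1 \<times> C2)) z * missed_mass (interior ?F) z = ?f (fst z) * ?g (snd z)"
    proof (cases "x \<in> interior C1 \<and> y \<in> interior C2")
      case True
      \<comment> \<open>Pointedness enters here: it keeps the apex out of both open cones.\<close>
      then have "x \<noteq> 0" "y \<noteq> 0" using C pointed_cone_zero_notin_interior by auto
      with True show ?thesis
        using missed_mass_free_sum[OF conv c1(3) c2(3) bdd] by (simp add: z interior_Times)
    qed (auto simp: z interior_Times)
  qed
  also have "\<dots> = (\<integral>\<^sup>+z. ?f (fst z) * ?g (snd z) \<partial>(lborel \<Otimes>\<^sub>M lborel))"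
    by (simp add: lborel_prod)
  also have "\<dots> = (\<integral>\<^sup>+x. (\<integral>\<^sup>+y. ?f x * ?g y \<partial>lborel) \<partial>lborel)"
    by (subst lborel.nn_integral_fst[symmetric]) auto
  also have "\<dots> = (\<integral>\<^sup>+x. ?f x * (\<integral>\<^sup>+y. ?g y \<partial>lborel) \<partial>lborel)"
    by (intro nn_integral_cong nn_integral_cmult) measurable
  also have "\<dots> = (\<integral>\<^sup>+x. ?f x \<partial>lborel) * (\<integral>\<^sup>+y. ?g y \<partial>lborel)"
    by (intro nn_integral_multc) measurable
  also have "\<dots> = Vol (coconvex_body C1 P1) * Vol (coconvex_body C2 P2)"
    using c1 c2 by (simp add: Vol_coconvex_body_eq_integral)
  finally show ?thesis by (simp add: coconvex_free_sum_def coconvex_body_def)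
qed

theorem proposition4p5:
  fixes C1 P1 K1 :: "(real ^ 'n1) set" and C2 P2 K2 :: "(real ^ 'n2) set"
  assumes "pointed_cone C1" and "pointed_cone C2"
    and "P1 \<subseteq> C1" and "convex P1" and "bounded (C1 - P1)"
    and "P2 \<subseteq> C2" and "convex P2" and "bounded (C2 - P2)"
    and "K1 = coconvex_body C1 P1" and "K2 = coconvex_body C2 P2"
  shows "Vol (coconvex_free_sum C1 P1 C2 P2) = Vol K1 * Vol K2"
  using assms by (simp add: Vol_coconvex_free_sum)

end
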